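(* Let $\mathcal{F}=\{\mathcal{P}(p)\mid p\in\mathbb{R}\setminus\{0\}\}$ be the confocal family of parabolas $\mathcal{P}(p): y^2=2px+p^2$, and for $E=(x_E,y_E)\in\mathbb{R}^2$ let $\mathcal{D}(E)$ be the unit circle centered at $E$. Put $$\mathcal{Q}^5_2(x,y,p)=4(x^2+y^2)p^2+4x(x^2+y^2-1)p-(x^2+y^2-1)^3,$$ and let $\Gamma^5$, $\Gamma^5_+$, $\Gamma^5_-$ be the sets of $(x,y)\in\mathbb{R}^2$ at which $(x^2+y^2-y)(x^2+y^2+y)$ is respectively $=0$, $>0$, $<0$. Let $S^1=\{(x,y)\in\mathbb{R}^2\mid x^2+y^2=1\}$ and $\Sigma=S^1\cup\{(0,0)\}$. Then there exist(s): a) two $5$-Poncelet pairs $(\mathcal{D}(E),\mathcal{P}(p_\pm))$, corresponding to the distinct real zeros in $p$ of $\mathcal{Q}^5_2(x_E,y_E,p)$, if $E\in\Gamma^5_+\setminus S^1$; the zeros are given by $$p_\pm(E)=\frac{\left(-x_E\pm\sqrt{(x_E^2+y_E^2)^2-y_E^2}\right)(x_E^2+y_E^2-1)}{2(x_E^2+y_E^2)};$$ b) one $5$-Poncelet pair $(\mathcal{D}(E),\mathcal{P}(p))$ if $E\in\Gamma^5\setminus\Sigma$, where $$p(E)=p_+(E)=p_-(E)=\frac{\sqrt{y_E}\,(1-y_E)^{3/2}}{2y_E},\qquad 0<y_E<1;$$ c) no real $5$-Poncelet pairs if $E\in\Gamma^5_-$.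
   Context: For $n\ge 3$ and two smooth conics $\mathcal{C}_1,\mathcal{C}_2$, an $n$-Poncelet polygon is an $n$-gon inscribed in $\mathcal{C}_1$ and circumscribed about $\mathcal{C}_2$ (the polygons are in general considered in $\mathbb{CP}^2$, so they need not be real); a $k$-gon traversed $m>1$ times is not regarded as an $mk$-gon. The pair $(\mathcal{C}_1,\mathcal{C}_2)$ is an $n$-Poncelet pair if there exists such an $n$-gon. The set $\Gamma^5$ is the union of the two circles $x^2+(y\pm\frac12)^2=\frac14$. All parabolas $\mathcal{P}(p)$ have focus $(0,0)$ and the $x$-axis as axis of symmetry.
   Formalization: In (b) the printed formula for p(E) has the wrong sign when x_E<0 and fails when y_E<0; the formal statement proves it for x_E,y_E>0 and, for all E in Γ^5∖Σ, with y_E replaced by |y_E| (0<|y_E|<1) and a factor sgn(x_E). *)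

theory Defs
  imports "HOL-Analysis.Analysis"
begin

section \<open>Conics in the complex projective plane\<close>

text \<open>Points of the complex projective plane are given by homogeneous coordinates, i.e. by
  nonzero vectors in \<^typ>\<open>complex^3\<close> up to a nonzero factor; a conic is given by the symmetric
  matrix of its quadratic form.\<close>

definition same_point :: "complex^3 \<Rightarrow> complex^3 \<Rightarrow> bool" where
  "same_point u v \<longleftrightarrow> (\<exists>c. c \<noteq> 0 \<and> v = c *s u)"

text \<open>The inner product of \<^typ>\<open>complex^3\<close> in the library is the real one, hence the explicit sum.\<close>

definition bilin :: "complex^3^3 \<Rightarrow> complex^3 \<Rightarrow> complex^3 \<Rightarrow> complex" where
  "bilin A u v = (\<Sum>i\<in>UNIV. \<Sum>j\<in>UNIV. A $ i $ j * u $ i * v $ j)"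

definition smooth_conic :: "complex^3^3 \<Rightarrow> bool" where
  "smooth_conic A \<longleftrightarrow> transpose A = A \<and> det A \<noteq> 0"

definition on_conic :: "complex^3^3 \<Rightarrow> complex^3 \<Rightarrow> bool" where
  "on_conic A v \<longleftrightarrow> v \<noteq> 0 \<and> bilin A v v = 0"

text \<open>For distinct points \<open>u\<close>, \<open>v\<close>: the line joining them is the tangent line of the conic at
  some point \<open>q\<close> of it, that line being the set of all \<open>w\<close> with \<open>bilin A q w = 0\<close>.\<close>

definition joining_line_tangent :: "complex^3^3 \<Rightarrow> complex^3 \<Rightarrow> complex^3 \<Rightarrow> bool" where
  "joining_line_tangent A u v \<longleftrightarrow>
     (\<exists>q. on_conic A q \<and> bilin A q u = 0 \<and> bilin A q v = 0)"


section \<open>Poncelet polygons\<close>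

text \<open>The vertices \<open>P 0, \<dots>, P (n - 1)\<close> are pairwise distinct points; this is what excludes
  multiply traversed polygons. As a line meets a smooth conic in at most two points, no three
  vertices are collinear, so the sides lie on pairwise distinct lines as well.\<close>

definition poncelet_polygon ::
    "nat \<Rightarrow> complex^3^3 \<Rightarrow> complex^3^3 \<Rightarrow> (nat \<Rightarrow> complex^3) \<Rightarrow> bool" where
  "poncelet_polygon n C1 C2 P \<longleftrightarrow>
     3 \<le> n \<and>
     (\<forall>i<n. on_conic C1 (P i)) \<and>
     (\<forall>i<n. \<forall>j<n. i \<noteq> j \<longrightarrow> \<not> same_point (P i) (P j)) \<and>
     (\<forall>i<n. joining_line_tangent C2 (P i) (P (Suc i mod n)))"

definition poncelet_pair :: "nat \<Rightarrow> complex^3^3 \<Rightarrow> complex^3^3 \<Rightarrow> bool" where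
  "poncelet_pair n C1 C2 \<longleftrightarrow>
     smooth_conic C1 \<and> smooth_conic C2 \<and> (\<exists>P. poncelet_polygon n C1 C2 P)"


section \<open>Unit circles and confocal parabolas\<close>

definition unit_circle_at :: "real \<Rightarrow> real \<Rightarrow> complex^3^3" where
  "unit_circle_at xE yE = map_matrix complex_of_real (vector
     [vector [1, 0, - xE],
      vector [0, 1, - yE],
      vector [- xE, - yE, xE\<^sup>2 + yE\<^sup>2 - 1]])"

definition parabola :: "real \<Rightarrow> complex^3^3" where
  "parabola p = map_matrix complex_of_real (vector
     [vector [0, 0, - p],
      vector [0, 1, 0],
      vector [- p, 0, - p\<^sup>2]])"

lemma bilin_unit_circle_at:
  "bilin (unit_circle_at xE yE) (vector [x, y, z]) (vector [x, y, z]) =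
     (x - of_real xE * z)\<^sup>2 + (y - of_real yE * z)\<^sup>2 - z\<^sup>2"
  by (simp add: bilin_def unit_circle_at_def map_matrix_def sum_3 power2_eq_square algebra_simps)

lemma bilin_parabola:
  "bilin (parabola p) (vector [x, y, z]) (vector [x, y, z]) =
     y\<^sup>2 - (2 * of_real p * x * z + (of_real p)\<^sup>2 * z\<^sup>2)"
  by (simp add: bilin_def parabola_def map_matrix_def sum_3 power2_eq_square algebra_simps)

lemma smooth_conic_unit_circle_at: "smooth_conic (unit_circle_at xE yE)"
  by (simp add: smooth_conic_def unit_circle_at_def map_matrix_def transpose_def det_3
      vec_eq_iff forall_3 power2_eq_square algebra_simps)

lemma smooth_conic_parabola_iff: "smooth_conic (parabola p) \<longleftrightarrow> p \<noteq> 0"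
  by (simp add: smooth_conic_def parabola_def map_matrix_def transpose_def det_3
      vec_eq_iff forall_3 power2_eq_square)


section \<open>The polynomial and the regions\<close>

definition Q52 :: "real \<Rightarrow> real \<Rightarrow> real \<Rightarrow> real" where
  "Q52 x y p = 4 * (x\<^sup>2 + y\<^sup>2) * p\<^sup>2 + 4 * x * (x\<^sup>2 + y\<^sup>2 - 1) * p - (x\<^sup>2 + y\<^sup>2 - 1) ^ 3"

definition Gamma5 :: "(real \<times> real) set" where
  "Gamma5 = {(x, y). (x\<^sup>2 + y\<^sup>2 - y) * (x\<^sup>2 + y\<^sup>2 + y) = 0}"

definition Gamma5_pos :: "(real \<times> real) set" where
  "Gamma5_pos = {(x, y). (x\<^sup>2 + y\<^sup>2 - y) * (x\<^sup>2 + y\<^sup>2 + y) > 0}"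

definition Gamma5_neg :: "(real \<times> real) set" where
  "Gamma5_neg = {(x, y). (x\<^sup>2 + y\<^sup>2 - y) * (x\<^sup>2 + y\<^sup>2 + y) < 0}"

definition S1 :: "(real \<times> real) set" where
  "S1 = {(x, y). x\<^sup>2 + y\<^sup>2 = 1}"

definition Sigma5 :: "(real \<times> real) set" where
  "Sigma5 = S1 \<union> {(0, 0)}"

definition p_plus :: "real \<Rightarrow> real \<Rightarrow> real" where
  "p_plus x y =
     (- x + sqrt ((x\<^sup>2 + y\<^sup>2)\<^sup>2 - y\<^sup>2)) * (x\<^sup>2 + y\<^sup>2 - 1) / (2 * (x\<^sup>2 + y\<^sup>2))"

definition p_minus :: "real \<Rightarrow> real \<Rightarrow> real" where
  "p_minus x y =
     (- x - sqrt ((x\<^sup>2 + y\<^sup>2)\<^sup>2 - y\<^sup>2)) * (x\<^sup>2 + y\<^sup>2 - 1) / (2 * (x\<^sup>2 + y\<^sup>2))"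

text \<open>The common value of \<^const>\<open>p_plus\<close> and \<^const>\<open>p_minus\<close> on \<^const>\<open>Gamma5\<close>. The formula
  \<open>sqrt y * (1 - y) powr (3/2) / (2 * y)\<close> is the case \<open>x > 0\<close>, \<open>0 < y < 1\<close>; reflection in the
  \<open>x\<close>-axis fixes each parabola and reflection in the \<open>y\<close>-axis replaces \<open>p\<close> by \<open>- p\<close>, whence the
  absolute value and the sign for the other quadrants.\<close>

definition p_double :: "real \<Rightarrow> real \<Rightarrow> real" where
  "p_double x y = sgn x * (sqrt \<bar>y\<bar> * (1 - \<bar>y\<bar>) powr (3 / 2) / (2 * \<bar>y\<bar>))"

end

theory Submission
  imports Defs
begin

text \<open>Let \<open>E = xE + \<i> yE\<close> and \<open>F = cnj E\<close>. Writing a point of the circle as \<open>(X - E, X' - F) = (u, 1/u)\<close>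
  in isotropic coordinates, the chord joining \<open>u\<close> and \<open>v\<close> is tangent to the parabola iff
  \<open>H(u, v) = E + F u\<^sup>2 v\<^sup>2 + d u v + (u + v) (1 + u v)\<close> vanishes, where \<open>d = 2 (xE + p)\<close>. The two
  circular points \<open>u = 0\<close>, \<open>u = \<infinity>\<close> are always adjacent, as the parabola touches the line at
  infinity; starting from this side, the polygon continues to \<open>-E\<close> and \<open>-1/F\<close>, and it closes after
  five steps iff \<open>e f = E F (E F - 1)\<^sup>2\<close> with \<open>e = E\<^sup>2 - E d + 1\<close> and \<open>f = F\<^sup>2 - F d + 1\<close>, which is the
  equation \<open>Q52 xE yE p = 0\<close>.

  That every other pentagon forces the same equation is an instance of Poncelet's closure theorem,
  but follows from one identity: if \<open>u1\<close>, \<open>u4\<close> are the neighbours of \<open>u0\<close> and \<open>u2\<close>, \<open>u3\<close> the next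
  vertices on either side, then \<open>H(u2, u3)\<close> is, up to a denominator,
  \<open>- (E F - 1) (e f - E F (E F - 1)\<^sup>2) H(u0, u0)\<close>, and \<open>H(u0, u0) \<noteq> 0\<close> because \<open>u0 \<noteq> u1, u4\<close>.
  This needs no case distinction for tangent conics.\<close>

section \<open>The tangency correspondence and its pentagons\<close>

text \<open>Parameters \<open>u = s / t\<close> are kept in homogeneous form \<open>(s, t)\<close>, so that \<open>(0, 1)\<close> and \<open>(1, 0)\<close>
  are the circular points.\<close>

definition edge_form ::
    "complex \<Rightarrow> complex \<Rightarrow> complex \<Rightarrow> complex \<times> complex \<Rightarrow> complex \<times> complex \<Rightarrow> complex" where
  "edge_form E F d = (\<lambda>(s, t) (s', t').
     E * (t * t')\<^sup>2 + F * (s * s')\<^sup>2 + d * (s * s') * (t * t') +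
     (s * t' + s' * t) * (s * s' + t * t'))"

definition cross :: "complex \<times> complex \<Rightarrow> complex \<times> complex \<Rightarrow> complex" where
  "cross = (\<lambda>(s, t) (s', t'). s * t' - s' * t)"

lemma edge_form_commute: "edge_form E F d P Q = edge_form E F d Q P"
  by (cases P; cases Q) (simp add: edge_form_def algebra_simps)

lemma cross_eq_0_commute: "cross P Q = 0 \<longleftrightarrow> cross Q P = 0"
  by (cases P; cases Q) (auto simp: cross_def algebra_simps)

lemma quadratic_vieta:
  fixes a b c x y :: complex
  assumes "a * x\<^sup>2 + b * x + c = 0" "a * y\<^sup>2 + b * y + c = 0" "x \<noteq> y"
  shows "a * (x + y) = - b" "a * (x * y) = c"
proof -
  have "(x - y) * (a * (x + y) + b) = 0" using assms(1,2) by algebra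
  then show *: "a * (x + y) = - b" using assms(3) by (simp add: eq_neg_iff_add_eq_0)
  show "a * (x * y) = c" using * assms(1) by algebra
qed

lemma affine_pentagon_closing:
  fixes E F d :: complex and u0 u1 u2 u3 u4 :: complex
  defines "H \<equiv> \<lambda>u v. E + F * (u * v)\<^sup>2 + d * (u * v) + (u + v) * (u * v + 1)"
  assumes H: "H u0 u1 = 0" "H u1 u2 = 0" "H u2 u3 = 0" "H u3 u4 = 0" "H u4 u0 = 0"
    and dist: "u1 \<noteq> u4" "u0 \<noteq> u2" "u0 \<noteq> u3" "u0 \<noteq> u1" "u0 \<noteq> u4"
    and "u0 \<noteq> 0" and EF: "E * F \<noteq> 1"
  shows "(E\<^sup>2 - E * d + 1) * (F\<^sup>2 - F * d + 1) = E * F * (E * F - 1)\<^sup>2"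
proof -
  define A B C D where "A = u0 * (F * u0 + 1)" and "B = u0\<^sup>2 + d * u0 + 1"
    and "C = u0 + E" and "D = F * u0 + 1"
  define e f g h where "e = E\<^sup>2 - E * d + 1" and "f = F\<^sup>2 - F * d + 1" and "g = E * F - 1"
    and "h = E * F * d - E - F"
  define L M where "L = E * g * u0 + e" and "M = f * u0 + F * g"
  have quad: "u * (F * u + 1) * v\<^sup>2 + (u\<^sup>2 + d * u + 1) * v + (u + E) = H u v" for u v
    by (simp add: H_def power2_eq_square algebra_simps)
  have sym: "H u v = H v u" for u v by (simp add: H_def algebra_simps)
  have S: "A * (u1 + u4) = - B" and T: "A * (u1 * u4) = C"
    using quadratic_vieta[of A u1 B C u4] quad[of u0] H dist sym unfolding A_def B_def C_def by auto
  have u2: "u1 * (F * u1 + 1) * (u0 * u2) = u1 + E"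
    using quadratic_vieta(2)[of "u1 * (F * u1 + 1)" u0 "u1\<^sup>2 + d * u1 + 1" "u1 + E" u2]
      quad[of u1] H dist sym by auto
  have u3: "u4 * (F * u4 + 1) * (u0 * u3) = u4 + E"
    using quadratic_vieta(2)[of "u4 * (F * u4 + 1)" u0 "u4\<^sup>2 + d * u4 + 1" "u4 + E" u3]
      quad[of u4] H dist sym by auto
  have "H u0 u0 \<noteq> 0"
  proof
    assume "H u0 u0 = 0"
    then have "A * (u1 + u0) = - B"
      using quadratic_vieta(1)[of A u1 B C u0] quad[of u0] H dist unfolding A_def B_def C_def by auto
    then have "A * (u0 - u4) = 0" using S by algebra
    then have "A = 0" using dist by simp
    then have "B = 0" "C = 0" using S T by auto
    show False using \<open>A = 0\<close> \<open>C = 0\<close> \<open>u0 \<noteq> 0\<close> EF unfolding A_def C_def by algebra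
  qed
  define N where "N = F\<^sup>2 * (u1 * u4) + F * (u1 + u4) + 1"
  have N: "A * N = M"
    using S T unfolding N_def A_def B_def C_def M_def f_def g_def by algebra
  have "A * (u1 * u4 + E * (u1 + u4) + E\<^sup>2) = u0 * L"
    using S T unfolding A_def B_def C_def L_def e_def g_def by algebra
  moreover have "u1 * u4 * N * (u0\<^sup>2 * (u2 * u3)) = u1 * u4 + E * (u1 + u4) + E\<^sup>2"
    using u2 u3 unfolding N_def by algebra
  ultimately have "C * M * (u0\<^sup>2 * (u2 * u3)) = A * (u0 * L)"
    using N T by algebra
  then have "u0\<^sup>2 * (C * M * (u2 * u3) - D * L) = 0" unfolding A_def D_def by algebra
  then have P: "C * M * (u2 * u3) = D * L" using \<open>u0 \<noteq> 0\<close> by simp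
  have "u1 * u4 * N * (u0 * (u2 + u3)) =
      (u1 + E) * (u4 * (F * u4 + 1)) + (u4 + E) * (u1 * (F * u1 + 1))"
    using u2 u3 unfolding N_def by algebra
  also have "\<dots> = - 2 * g * (u1 * u4) + F * (u1 * u4) * (u1 + u4) + E * (u1 + u4) + E * F * (u1 + u4)\<^sup>2"
    unfolding g_def by algebra
  finally have "C * M * (u0 * (u2 + u3)) = - 2 * g * C * A - F * C * B - E * B * A + E * F * B\<^sup>2"
    using N S T by algebra
  also have "\<dots> = u0 * (B * h - 2 * g * C * D)"
    unfolding A_def B_def C_def D_def h_def by algebra
  finally have "u0 * (C * M * (u2 + u3) - (B * h - 2 * g * C * D)) = 0" by algebra
  then have Sig: "C * M * (u2 + u3) = B * h - 2 * g * C * D" using \<open>u0 \<noteq> 0\<close> by simp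
  have "(C * M)\<^sup>2 * H u2 u3 = E * (C * M)\<^sup>2 + F * (C * M * (u2 * u3))\<^sup>2 + d * (C * M * (u2 * u3)) * (C * M) +
      C * M * (u2 + u3) * (C * M * (u2 * u3) + C * M)"
    unfolding H_def by algebra
  also have "\<dots> = - g * (e * f - E * F * g\<^sup>2) * H u0 u0"
    unfolding P Sig
    unfolding H_def A_def B_def C_def D_def L_def M_def e_def f_def g_def h_def by algebra
  finally have "e * f = E * F * g\<^sup>2"
    using H(3) \<open>H u0 u0 \<noteq> 0\<close> EF by (simp add: g_def)
  then show ?thesis unfolding e_def f_def g_def .
qed


definition pentagon ::
    "complex \<Rightarrow> complex \<Rightarrow> complex \<Rightarrow> complex \<times> complex \<Rightarrow> complex \<times> complex \<Rightarrow> complex \<times> complex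
      \<Rightarrow> complex \<times> complex \<Rightarrow> complex \<times> complex \<Rightarrow> bool" where
  "pentagon E F d P0 P1 P2 P3 P4 \<longleftrightarrow>
     edge_form E F d P0 P1 = 0 \<and> edge_form E F d P1 P2 = 0 \<and> edge_form E F d P2 P3 = 0 \<and>
     edge_form E F d P3 P4 = 0 \<and> edge_form E F d P4 P0 = 0 \<and>
     cross P0 P1 \<noteq> 0 \<and> cross P0 P2 \<noteq> 0 \<and> cross P0 P3 \<noteq> 0 \<and> cross P0 P4 \<noteq> 0 \<and> cross P1 P2 \<noteq> 0 \<and>
     cross P1 P3 \<noteq> 0 \<and> cross P1 P4 \<noteq> 0 \<and> cross P2 P3 \<noteq> 0 \<and> cross P2 P4 \<noteq> 0 \<and> cross P3 P4 \<noteq> 0"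

lemma pentagon_rotate:
  "pentagon E F d P0 P1 P2 P3 P4 \<Longrightarrow> pentagon E F d P1 P2 P3 P4 P0"
  unfolding pentagon_def using cross_eq_0_commute by blast

lemma pentagon_reflect:
  "pentagon E F d P0 P1 P2 P3 P4 \<Longrightarrow> pentagon E F d P0 P4 P3 P2 P1"
  unfolding pentagon_def using cross_eq_0_commute edge_form_commute by metis

lemma edge_form_0:
  "edge_form E F d (0, t) (s', t') = t\<^sup>2 * t' * (E * t' + s')"
  by (simp add: edge_form_def power2_eq_square algebra_simps)

lemma edge_form_infinity:
  "edge_form E F d (s, 0) (s', t') = s\<^sup>2 * s' * (F * s' + t')"
  by (simp add: edge_form_def power2_eq_square algebra_simps)

definition pentagon_cond :: "complex \<Rightarrow> complex \<Rightarrow> complex \<Rightarrow> bool" where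
  "pentagon_cond E F d \<longleftrightarrow>
     (E\<^sup>2 - E * d + 1) * (F\<^sup>2 - F * d + 1) = E * F * (E * F - 1)\<^sup>2"

lemma pentagon_cond_if_infinite_side:
  assumes "pentagon E F d (0, t0) (s1, 0) P2 P3 P4"
  shows "pentagon_cond E F d"
proof -
  obtain s2 t2 s3 t3 s4 t4 where P: "P2 = (s2, t2)" "P3 = (s3, t3)" "P4 = (s4, t4)"
    by (metis surj_pair)
  note pent = assms[unfolded pentagon_def P]
  have nz: "t0 \<noteq> 0" "s1 \<noteq> 0" "s2 \<noteq> 0" "t2 \<noteq> 0" "s3 \<noteq> 0" "t3 \<noteq> 0" "s4 \<noteq> 0" "t4 \<noteq> 0"
    using pent by (auto simp: cross_def)
  have t2: "t2 = - F * s2"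
    using pent nz by (auto simp: edge_form_infinity add_eq_0_iff)
  have s4: "s4 = - E * t4"
    using pent nz edge_form_commute[of E F d "(s4, t4)" "(0, t0)"] by (auto simp: edge_form_0 add_eq_0_iff)
  have "s2\<^sup>2 * t3 * ((F\<^sup>2 - F * d + 1) * s3 + F * (E * F - 1) * t3) = edge_form E F d (s2, t2) (s3, t3)"
    unfolding edge_form_def prod.case t2 by algebra
  then have 1: "(F\<^sup>2 - F * d + 1) * s3 = - F * (E * F - 1) * t3"
    using pent nz by (auto simp: add_eq_0_iff)
  have "t4\<^sup>2 * s3 * ((E\<^sup>2 - E * d + 1) * t3 + E * (E * F - 1) * s3) = edge_form E F d (s3, t3) (s4, t4)"
    unfolding edge_form_def prod.case s4 by algebra
  then have 2: "(E\<^sup>2 - E * d + 1) * t3 = - E * (E * F - 1) * s3"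
    using pent nz by (auto simp: add_eq_0_iff)
  have "(s3 * t3) * ((E\<^sup>2 - E * d + 1) * (F\<^sup>2 - F * d + 1) - E * F * (E * F - 1)\<^sup>2) = 0"
    using 1 2 by algebra
  then show ?thesis using nz by (simp add: pentagon_cond_def)
qed

lemma pentagon_cond_if_origin:
  assumes "pentagon E F d (0, t0) P1 P2 P3 P4"
  shows "pentagon_cond E F d"
proof -
  obtain s1 t1 s4 t4 where P: "P1 = (s1, t1)" "P4 = (s4, t4)" by (metis surj_pair)
  note pent = assms[unfolded pentagon_def P]
  have "t0 \<noteq> 0" using pent by (auto simp: cross_def)
  then have "t1 = 0 \<or> s1 = - E * t1" "t4 = 0 \<or> s4 = - E * t4"
    using pent edge_form_commute[of E F d "(s4, t4)" "(0, t0)"]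
    by (auto simp: edge_form_0 add_eq_0_iff)
  moreover have "s1 * t4 - s4 * t1 \<noteq> 0" using pent by (auto simp: cross_def)
  ultimately have "t1 = 0 \<or> t4 = 0" by auto
  then show ?thesis
    using pentagon_cond_if_infinite_side assms pentagon_reflect P by blast
qed

lemma pentagon_cond_if_infinity:
  assumes "pentagon E F d (s0, 0) P1 P2 P3 P4"
  shows "pentagon_cond E F d"
proof -
  obtain s1 t1 s4 t4 where P: "P1 = (s1, t1)" "P4 = (s4, t4)" by (metis surj_pair)
  note pent = assms[unfolded pentagon_def P]
  have "s0 \<noteq> 0" using pent by (auto simp: cross_def)
  then have "s1 = 0 \<or> t1 = - F * s1" "s4 = 0 \<or> t4 = - F * s4"
    using pent edge_form_commute[of E F d "(s4, t4)" "(s0, 0)"]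
    by (auto simp: edge_form_infinity add_eq_0_iff)
  moreover have "s1 * t4 - s4 * t1 \<noteq> 0" using pent by (auto simp: cross_def)
  ultimately have "s1 = 0 \<or> s4 = 0" by auto
  then show ?thesis
    using pentagon_cond_if_origin[of E F d t1] pentagon_cond_if_origin[of E F d t4]
      pentagon_rotate[OF assms] pentagon_rotate[OF pentagon_reflect[OF assms]] P
    by blast
qed

lemma edge_form_affine:
  assumes "t \<noteq> 0" "t' \<noteq> 0"
  shows "edge_form E F d (s, t) (s', t') = (t * t')\<^sup>2 *
    (E + F * ((s / t) * (s' / t'))\<^sup>2 + d * ((s / t) * (s' / t')) +
     (s / t + s' / t') * ((s / t) * (s' / t') + 1))"
  using assms by (simp add: edge_form_def field_simps power2_eq_square)

lemma cross_affine:
  assumes "t \<noteq> 0" "t' \<noteq> 0"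
  shows "cross (s, t) (s', t') = 0 \<longleftrightarrow> s / t = s' / t'"
  using assms by (simp add: cross_def field_simps)

lemma pentagon_closing:
  assumes pent: "pentagon E F d P0 P1 P2 P3 P4" and EF: "E * F \<noteq> 1"
  shows "pentagon_cond E F d"
proof -
  obtain s0 t0 s1 t1 s2 t2 s3 t3 s4 t4 where
    P: "P0 = (s0, t0)" "P1 = (s1, t1)" "P2 = (s2, t2)" "P3 = (s3, t3)" "P4 = (s4, t4)"
    by (metis surj_pair)
  show ?thesis
  proof (cases "s0 = 0 \<or> t0 = 0 \<or> t1 = 0 \<or> t2 = 0 \<or> t3 = 0 \<or> t4 = 0")
    case True
    note rot1 = pentagon_rotate[OF pent]
    note rot2 = pentagon_rotate[OF rot1]
    note rot3 = pentagon_rotate[OF rot2]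
    note rot4 = pentagon_rotate[OF rot3]
    from True show ?thesis
    proof (elim disjE)
      assume "s0 = 0"
      then show ?thesis using pent P pentagon_cond_if_origin by simp
    next
      assume "t0 = 0"
      then show ?thesis using pent P pentagon_cond_if_infinity by simp
    next
      assume "t1 = 0"
      then show ?thesis using rot1 P(2) pentagon_cond_if_infinity by simp
    next
      assume "t2 = 0"
      then show ?thesis using rot2 P(3) pentagon_cond_if_infinity by simp
    next
      assume "t3 = 0"
      then show ?thesis using rot3 P(4) pentagon_cond_if_infinity by simp
    next
      assume "t4 = 0"
      then show ?thesis using rot4 P(5) pentagon_cond_if_infinity by simp
    qed
  next
    case False
    then show ?thesis
      using pent affine_pentagon_closing[of E F "s0 / t0" "s1 / t1" d "s2 / t2" "s3 / t3" "s4 / t4"] EF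
      unfolding pentagon_def P pentagon_cond_def
      by (auto simp: edge_form_affine cross_affine)
  qed
qed

lemma pentagon_exists:
  assumes "pentagon_cond E F d" "E \<noteq> 0" "F \<noteq> 0" "E * F \<noteq> 1"
  shows "pentagon E F d (0, 1) (1, 0) (1, - F) (- (E\<^sup>2 - E * d + 1), E * (E * F - 1)) (- E, 1)"
proof -
  define e f g where "e = E\<^sup>2 - E * d + 1" and "f = F\<^sup>2 - F * d + 1" and "g = E * F - 1"
  have g: "g \<noteq> 0" using assms by (simp add: g_def)
  have ef: "e * f = E * F * g\<^sup>2"
    using assms(1) unfolding pentagon_cond_def e_def f_def g_def .
  have e0: "e \<noteq> 0" using ef assms g by auto
  have fg: "E * g - F * e = F * g - E * f" unfolding e_def f_def g_def by algebra
  have "F * e \<noteq> E * g"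
  proof
    assume *: "F * e = E * g"
    then have "F * g = E * f" using fg by simp
    then have "E * g * g * g = 0" using * ef unfolding g_def by algebra
    then show False using g assms by simp
  qed
  moreover have "e \<noteq> E\<^sup>2 * g"
  proof
    assume *: "e = E\<^sup>2 * g"
    then have "E * F * g * (E * f - F * g) = 0" using ef by algebra
    then have "E * f = F * g" using g assms by simp
    then have "F * e = E * g" using fg by simp
    then have "E * g * g = 0" using * unfolding g_def by algebra
    then show False using g assms by simp
  qed
  moreover have "edge_form E F d (1, - F) (- e, E * g) = 0"
  proof -
    have "edge_form E F d (1, - F) (- e, E * g) = E * g * (E * F * g\<^sup>2 - e * f)"
      unfolding edge_form_def prod.case e_def f_def g_def by algebra
    then show ?thesis using ef by simp
  qed
  moreover have "edge_form E F d (- e, E * g) (- E, 1) = 0"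
    unfolding edge_form_def prod.case e_def g_def by algebra
  ultimately show ?thesis
    using assms g e0 unfolding e_def[symmetric] g_def[symmetric]
    unfolding pentagon_def
    by (auto simp: edge_form_def cross_def g_def power2_eq_square algebra_simps)
qed

section \<open>Chords of the circle tangent to the parabola\<close>

definition circle_point :: "real \<Rightarrow> real \<Rightarrow> complex \<times> complex \<Rightarrow> complex^3" where
  "circle_point x y = (\<lambda>(s, t). vector
     [(s\<^sup>2 + t\<^sup>2) / 2 + of_real x * s * t, (s\<^sup>2 - t\<^sup>2) / (2 * \<i>) + of_real y * s * t, s * t])"

lemma circle_point_components:
  "circle_point x y (s, t) $ 1 = (s\<^sup>2 + t\<^sup>2) / 2 + of_real x * s * t"
  "circle_point x y (s, t) $ 2 = (s\<^sup>2 - t\<^sup>2) / (2 * \<i>) + of_real y * s * t"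
  "circle_point x y (s, t) $ 3 = s * t"
  by (simp_all add: circle_point_def)

lemma vector_3_eta: "v = vector [v $ 1, v $ 2, v $ 3]" for v :: "complex^3"
  by (simp add: vec_eq_iff forall_3)

lemma circle_point_squares:
  "(circle_point x y (s, t) $ 1 - of_real x * (s * t)) + \<i> * (circle_point x y (s, t) $ 2 - of_real y * (s * t)) = s\<^sup>2"
  "(circle_point x y (s, t) $ 1 - of_real x * (s * t)) - \<i> * (circle_point x y (s, t) $ 2 - of_real y * (s * t)) = t\<^sup>2"
  by (simp_all add: circle_point_components field_simps)

lemma on_conic_circle_point:
  assumes "P \<noteq> (0, 0)"
  shows "on_conic (unit_circle_at x y) (circle_point x y P)"
proof -
  obtain s t where P: "P = (s, t)" by (cases P)
  have "circle_point x y P \<noteq> 0"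
  proof
    assume "circle_point x y P = 0"
    then have "s\<^sup>2 = 0" "t\<^sup>2 = 0"
      using circle_point_squares[of x y s t] circle_point_components(3)[of x y s t] unfolding P by auto
    then show False using assms P by auto
  qed
  moreover have "bilin (unit_circle_at x y) (circle_point x y P) (circle_point x y P) = 0"
    unfolding P circle_point_def prod.case bilin_unit_circle_at
    by (simp add: field_simps power2_eq_square)
  ultimately show ?thesis by (simp add: on_conic_def)
qed

lemma on_conic_circle_pointE:
  assumes "on_conic (unit_circle_at x y) v"
  obtains P where "P \<noteq> (0, 0)" "v = circle_point x y P"
proof -
  define z a b where "z = v $ 3"
    and "a = (v $ 1 - of_real x * z) + \<i> * (v $ 2 - of_real y * z)"
    and "b = (v $ 1 - of_real x * z) - \<i> * (v $ 2 - of_real y * z)"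
  have "(v $ 1 - of_real x * z)\<^sup>2 + (v $ 2 - of_real y * z)\<^sup>2 - z\<^sup>2 = 0"
    using assms bilin_unit_circle_at[of x y "v $ 1" "v $ 2" "v $ 3"]
    unfolding on_conic_def vector_3_eta[of v, symmetric] z_def by simp
  then have ab: "a * b = z\<^sup>2"
    unfolding a_def b_def by (simp add: algebra_simps power2_eq_square)
  have "\<exists>s t. a = s\<^sup>2 \<and> b = t\<^sup>2 \<and> z = s * t"
  proof (cases "csqrt b = 0")
    case True
    then show ?thesis using ab by (intro exI[of _ "csqrt a"] exI[of _ 0]) auto
  next
    case False
    have "a = (z / csqrt b)\<^sup>2" using ab False by (simp add: field_simps power_divide)
    then show ?thesis using False by (intro exI[of _ "z / csqrt b"] exI[of _ "csqrt b"]) auto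
  qed
  then obtain s t where st: "a = s\<^sup>2" "b = t\<^sup>2" "z = s * t" by blast
  have v12: "v $ 1 = (a + b) / 2 + of_real x * z" "v $ 2 = (a - b) / (2 * \<i>) + of_real y * z"
    unfolding a_def b_def by (simp_all add: field_simps)
  have v: "v = circle_point x y (s, t)"
    using v12 st z_def by (simp add: vec_eq_iff forall_3 circle_point_components algebra_simps)
  moreover have "(s, t) \<noteq> (0, 0)"
  proof
    assume "(s, t) = (0, 0)"
    then have "v = 0" unfolding v by (simp add: vec_eq_iff forall_3 circle_point_components)
    then show False using assms by (simp add: on_conic_def)
  qed
  ultimately show ?thesis using that by blast
qed

lemma same_point_circle_point:
  assumes "P \<noteq> (0, 0)" "Q \<noteq> (0, 0)"
  shows "same_point (circle_point x y P) (circle_point x y Q) \<longleftrightarrow> cross P Q = 0"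
proof -
  obtain s t s' t' where PQ: "P = (s, t)" "Q = (s', t')" by (cases P; cases Q)
  show ?thesis
  proof
    assume "same_point (circle_point x y P) (circle_point x y Q)"
    then obtain c where c: "circle_point x y (s', t') = c *s circle_point x y (s, t)"
      unfolding same_point_def PQ by blast
    have 1: "s' * t' = c * (s * t)"
      using c circle_point_components(3) by (metis vector_smult_component)
    have 2: "circle_point x y (s', t') $ i = c * circle_point x y (s, t) $ i" for i
      using c by simp
    have "s'\<^sup>2 = c * s\<^sup>2" "t'\<^sup>2 = c * t\<^sup>2"
      using circle_point_squares[of x y s t] circle_point_squares[of x y s' t', unfolded 1 2]
      by algebra+
    then have "(s * t' - s' * t)\<^sup>2 = 0" using 1 by algebra
    then show "cross P Q = 0" by (simp add: cross_def PQ)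
  next
    assume "cross P Q = 0"
    then have st: "s * t' = s' * t" by (simp add: cross_def PQ)
    obtain r where r: "r \<noteq> 0" "s' = r * s" "t' = r * t"
    proof (cases "s = 0")
      case True
      then show ?thesis using assms st that[of "t' / t"] by (auto simp: PQ)
    next
      case False
      moreover have "s' \<noteq> 0" using assms st False by (auto simp: PQ)
      ultimately show ?thesis using st that[of "s' / s"] by (auto simp: field_simps)
    qed
    have "circle_point x y Q = r\<^sup>2 *s circle_point x y P"
      unfolding PQ r by (simp add: vec_eq_iff forall_3 circle_point_components field_simps power2_eq_square)
    then show "same_point (circle_point x y P) (circle_point x y Q)"
      unfolding same_point_def using r by (metis power2_eq_square mult_eq_0_iff)
  qed
qed

lemma binary_quadratic_vieta:
  fixes a b c s t s' t' :: complex
  assumes "a * s\<^sup>2 + b * (s * t) + c * t\<^sup>2 = 0" "a * s'\<^sup>2 + b * (s' * t') + c * t'\<^sup>2 = 0"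
    and d: "s * t' - s' * t \<noteq> 0"
  obtains l where "a = l * (t * t')" "b = - l * (s * t' + s' * t)" "c = l * (s * s')"
proof -
  define u v w where "u = t * t'" and "v = s * t' + s' * t" and "w = s * s'"
  have "(s * t' - s' * t) * (a * v + b * u) = 0" "(s * t' - s' * t) * (c * v + b * w) = 0"
    "(s * t' - s' * t) * (a * w - c * u) = 0"
    using assms(1,2) unfolding u_def v_def w_def by algebra+
  then have eqs: "a * v + b * u = 0" "c * v + b * w = 0" "a * w - c * u = 0" using d by auto
  have "(s * t' - s' * t)\<^sup>2 = v\<^sup>2 - 4 * u * w" unfolding u_def v_def w_def by algebra
  then have "u \<noteq> 0 \<or> v \<noteq> 0 \<or> w \<noteq> 0" using d by auto
  then have "\<exists>l. a = l * u \<and> b = - l * v \<and> c = l * w"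
  proof (elim disjE)
    assume "u \<noteq> 0"
    then show ?thesis using eqs by (intro exI[of _ "a / u"]) (auto simp: field_simps add_eq_0_iff)
  next
    assume "v \<noteq> 0"
    then show ?thesis using eqs by (intro exI[of _ "- b / v"]) (auto simp: field_simps add_eq_0_iff)
  next
    assume "w \<noteq> 0"
    then show ?thesis using eqs by (intro exI[of _ "c / w"]) (auto simp: field_simps add_eq_0_iff)
  qed
  then show ?thesis using that unfolding u_def v_def w_def by auto
qed

lemma bilin_parabola_polar:
  "bilin (parabola p) q w =
     - of_real p * q $ 3 * w $ 1 + q $ 2 * w $ 2 - (of_real p * q $ 1 + (of_real p)\<^sup>2 * q $ 3) * w $ 3"
  by (simp add: bilin_def parabola_def map_matrix_def sum_3 power2_eq_square algebra_simps)

text \<open>The line with coordinates \<open>a + c\<close>, \<open>\<i> (a - c)\<close>, \<open>l\<close> is written so that \<open>a\<close> and \<open>c\<close> are the outer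
  coefficients of its restriction to the circle.\<close>

lemma line_on_circle_point:
  fixes a c l E :: complex and x y :: real
  assumes "E = Complex x y"
  shows "(a + c) * circle_point x y (s, t) $ 1 + \<i> * (a - c) * circle_point x y (s, t) $ 2
      + l * circle_point x y (s, t) $ 3
    = a * s\<^sup>2 + (E * a + cnj E * c + l) * (s * t) + c * t\<^sup>2"
proof -
  have E: "E = of_real x + \<i> * of_real y" "cnj E = of_real x - \<i> * of_real y"
    using assms by (simp_all add: complex_eq_iff)
  have 1: "\<i> * circle_point x y (s, t) $ 2 = (s\<^sup>2 - t\<^sup>2) / 2 + \<i> * of_real y * (s * t)"
    unfolding circle_point_components by (simp add: field_simps)
  have "(a + c) * circle_point x y (s, t) $ 1 + \<i> * (a - c) * circle_point x y (s, t) $ 2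
      + l * circle_point x y (s, t) $ 3
    = (a + c) * circle_point x y (s, t) $ 1 + (a - c) * (\<i> * circle_point x y (s, t) $ 2)
      + l * circle_point x y (s, t) $ 3"
    by (simp only: mult.assoc mult.left_commute)
  also have "\<dots> = (a + c) * ((s\<^sup>2 + t\<^sup>2) / 2 + of_real x * s * t)
      + (a - c) * ((s\<^sup>2 - t\<^sup>2) / 2 + \<i> * of_real y * (s * t)) + l * (s * t)"
    unfolding 1 unfolding circle_point_components ..
  also have "\<dots> = a * s\<^sup>2 + (E * a + cnj E * c + l) * (s * t) + c * t\<^sup>2"
  proof -
    have "(a + c) * ((s\<^sup>2 + t\<^sup>2) / 2) + (a - c) * ((s\<^sup>2 - t\<^sup>2) / 2) = a * s\<^sup>2 + c * t\<^sup>2"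
      by (simp add: field_simps)
    then show ?thesis unfolding E(2) unfolding E(1) by (simp add: algebra_simps)
  qed
  finally show ?thesis .
qed

lemma joining_line_tangent_iff:
  fixes x y p :: real and P Q :: "complex \<times> complex"
  defines "E \<equiv> Complex x y"
  assumes p: "p \<noteq> 0" and PQ: "cross P Q \<noteq> 0"
  shows "joining_line_tangent (parabola p) (circle_point x y P) (circle_point x y Q) \<longleftrightarrow>
    edge_form E (cnj E) (of_real (2 * x + 2 * p)) P Q = 0"
proof -
  obtain s t s' t' where st: "P = (s, t)" "Q = (s', t')" by (cases P; cases Q)
  define F where "F = cnj E"
  define \<sigma> \<pi> \<tau> where "\<sigma> = s * t' + s' * t" and "\<pi> = s * s'" and "\<tau> = t * t'"
  have d: "s * t' - s' * t \<noteq> 0" using PQ by (simp add: cross_def st)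
  have x: "E + F = 2 * of_real x" unfolding E_def F_def by (simp add: complex_eq_iff)
  have form: "edge_form E F (of_real (2 * x + 2 * p)) P Q
      = (\<pi> + \<tau>) * (E * \<tau> + F * \<pi> + \<sigma>) + 2 * of_real p * \<pi> * \<tau>"
  proof -
    have d: "of_real (2 * x + 2 * p) = E + F + 2 * of_real p" using x by simp
    show ?thesis
      unfolding d edge_form_def st prod.case \<sigma>_def \<pi>_def \<tau>_def by algebra
  qed
  show ?thesis unfolding F_def[symmetric] form
  proof
    assume "joining_line_tangent (parabola p) (circle_point x y P) (circle_point x y Q)"
    then obtain q where q: "on_conic (parabola p) q"
      "bilin (parabola p) q (circle_point x y P) = 0" "bilin (parabola p) q (circle_point x y Q) = 0"
      unfolding joining_line_tangent_def by blast
    define a c l where "a = (- of_real p * q $ 3 - \<i> * q $ 2) / 2"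
      and "c = (- of_real p * q $ 3 + \<i> * q $ 2) / 2"
      and "l = - (of_real p * q $ 1 + (of_real p)\<^sup>2 * q $ 3)"
    define b where "b = E * a + F * c + l"
    have ac: "a + c = - of_real p * q $ 3" "\<i> * (a - c) = q $ 2"
      unfolding a_def c_def by (simp_all add: field_simps)
    have "bilin (parabola p) q (circle_point x y (s, t)) = a * s\<^sup>2 + b * (s * t) + c * t\<^sup>2" for s t
    proof -
      have "bilin (parabola p) q (circle_point x y (s, t)) = (- of_real p * q $ 3) * circle_point x y (s, t) $ 1 +
          q $ 2 * circle_point x y (s, t) $ 2 + l * circle_point x y (s, t) $ 3"
        unfolding bilin_parabola_polar l_def by algebra
      also have "\<dots> = a * s\<^sup>2 + b * (s * t) + c * t\<^sup>2"
        unfolding ac[symmetric] b_def unfolding F_def by (rule line_on_circle_point) (simp add: E_def)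
      finally show ?thesis .
    qed
    then have "a * s\<^sup>2 + b * (s * t) + c * t\<^sup>2 = 0" "a * s'\<^sup>2 + b * (s' * t') + c * t'\<^sup>2 = 0"
      using q(2,3) unfolding st by simp_all
    then obtain m where m: "a = m * \<tau>" "b = - m * \<sigma>" "c = m * \<pi>"
      using binary_quadratic_vieta[OF _ _ d] unfolding \<sigma>_def \<pi>_def \<tau>_def by metis
    have "(q $ 2)\<^sup>2 = 2 * of_real p * q $ 1 * q $ 3 + (of_real p)\<^sup>2 * (q $ 3)\<^sup>2"
      using q(1) bilin_parabola[of p "q $ 1" "q $ 2" "q $ 3"]
      unfolding on_conic_def vector_3_eta[of q, symmetric] by simp
    moreover have "4 * (a * c) = (of_real p * q $ 3)\<^sup>2 + (q $ 2)\<^sup>2"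
      unfolding a_def c_def by (simp add: power2_eq_square algebra_simps)
    ultimately have "4 * (a * c) = 2 * of_real p * q $ 1 * q $ 3 + 2 * (of_real p * q $ 3)\<^sup>2"
      by (simp add: power_mult_distrib)
    then have "of_real p * (4 * (a * c)) = 2 * ((a + c) * l)"
      unfolding ac l_def by algebra
    then have "2 * of_real p * (a * c) = (a + c) * l" by algebra
    moreover have l: "l = - m * (\<sigma> + E * \<tau> + F * \<pi>)"
      using b_def unfolding m by algebra
    ultimately have "m\<^sup>2 * ((\<pi> + \<tau>) * (E * \<tau> + F * \<pi> + \<sigma>) + 2 * of_real p * \<pi> * \<tau>) = 0"
      unfolding m l by algebra
    moreover have "m \<noteq> 0"
    proof
      assume "m = 0"
      then have "a = 0" "b = 0" "c = 0" using m by auto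
      then have "q $ 3 = 0" "q $ 2 = 0" "l = 0" using ac p b_def by auto
      then have "q = 0" using p unfolding l_def by (simp add: vec_eq_iff forall_3)
      then show False using q(1) by (simp add: on_conic_def)
    qed
    ultimately show "(\<pi> + \<tau>) * (E * \<tau> + F * \<pi> + \<sigma>) + 2 * of_real p * \<pi> * \<tau> = 0" by simp
  next
    assume *: "(\<pi> + \<tau>) * (E * \<tau> + F * \<pi> + \<sigma>) + 2 * of_real p * \<pi> * \<tau> = 0"
    define l where "l = - (\<sigma> + E * \<tau> + F * \<pi>)"
    define q :: "complex^3" where
      "q = vector [(\<tau> + \<pi>) - l / of_real p, \<i> * (\<tau> - \<pi>), - (\<tau> + \<pi>) / of_real p]"
    have q: "- of_real p * q $ 3 = \<tau> + \<pi>" "q $ 2 = \<i> * (\<tau> - \<pi>)"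
      "- (of_real p * q $ 1 + (of_real p)\<^sup>2 * q $ 3) = l"
      unfolding q_def using p by (simp_all add: field_simps power2_eq_square)
    have bil: "bilin (parabola p) q (circle_point x y (s, t)) = \<tau> * s\<^sup>2 - \<sigma> * (s * t) + \<pi> * t\<^sup>2" for s t
    proof -
      have "bilin (parabola p) q (circle_point x y (s, t)) = (- of_real p * q $ 3) * circle_point x y (s, t) $ 1 +
          q $ 2 * circle_point x y (s, t) $ 2 +
          (- (of_real p * q $ 1 + (of_real p)\<^sup>2 * q $ 3)) * circle_point x y (s, t) $ 3"
        unfolding bilin_parabola_polar by algebra
      also have "\<dots> = \<tau> * s\<^sup>2 + (E * \<tau> + F * \<pi> + l) * (s * t) + \<pi> * t\<^sup>2"
        unfolding q unfolding F_def by (rule line_on_circle_point) (simp add: E_def)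
      also have "E * \<tau> + F * \<pi> + l = - \<sigma>" unfolding l_def by simp
      finally show ?thesis by simp
    qed
    have "bilin (parabola p) q (circle_point x y P) = 0" "bilin (parabola p) q (circle_point x y Q) = 0"
      unfolding st bil \<sigma>_def \<pi>_def \<tau>_def by algebra+
    moreover have "q \<noteq> 0"
    proof
      assume "q = 0"
      then have "\<tau> + \<pi> = 0" "\<tau> - \<pi> = 0" "l = 0" using q by auto
      then have "\<tau> = 0" "\<pi> = 0" by (simp_all add: add_eq_0_iff)
      moreover have "\<sigma> = 0" using \<open>l = 0\<close> \<open>\<tau> = 0\<close> \<open>\<pi> = 0\<close> by (simp add: l_def)
      moreover have "(s * t' - s' * t)\<^sup>2 = \<sigma>\<^sup>2 - 4 * \<pi> * \<tau>" unfolding \<sigma>_def \<pi>_def \<tau>_def by algebra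
      ultimately have "(s * t' - s' * t)\<^sup>2 = 0" by simp
      then show False using d by simp
    qed
    moreover have "bilin (parabola p) q q = 0"
    proof -
      have bq: "bilin (parabola p) q q = (q $ 2)\<^sup>2 - (2 * of_real p * q $ 1 * q $ 3 + (of_real p)\<^sup>2 * (q $ 3)\<^sup>2)"
        using bilin_parabola[of p "q $ 1" "q $ 2" "q $ 3"] unfolding vector_3_eta[of q, symmetric] .
      have "of_real p * bilin (parabola p) q q =
          of_real p * (q $ 2)\<^sup>2 - 2 * (of_real p * q $ 1) * (of_real p * q $ 3) - of_real p * (of_real p * q $ 3)\<^sup>2"
        unfolding bq by algebra
      also have "of_real p * q $ 3 = - (\<tau> + \<pi>)" using q(1) by algebra
      also have "of_real p * q $ 1 = of_real p * (\<tau> + \<pi>) - l" using q(1,3) by algebra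
      also have "(q $ 2)\<^sup>2 = - (\<tau> - \<pi>)\<^sup>2" unfolding q(2) by (simp add: power_mult_distrib)
      also have "of_real p * - (\<tau> - \<pi>)\<^sup>2 - 2 * (of_real p * (\<tau> + \<pi>) - l) * - (\<tau> + \<pi>) -
          of_real p * (- (\<tau> + \<pi>))\<^sup>2 = 4 * of_real p * \<tau> * \<pi> - 2 * (\<tau> + \<pi>) * l"
        by algebra
      also have "\<dots> = 0" using * unfolding l_def by algebra
      finally have "of_real p * bilin (parabola p) q q = 0" .
      then show ?thesis using p by simp
    qed
    ultimately show "joining_line_tangent (parabola p) (circle_point x y P) (circle_point x y Q)"
      unfolding joining_line_tangent_def on_conic_def by blast
  qed
qed

section \<open>The pentagon condition in real terms\<close>

lemma lessThan_5_nat: "{..<5} = {0, 1, 2, 3, 4::nat}"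
  by auto

lemma pentagon_cond_iff_Q52:
  fixes x y p :: real
  defines "E \<equiv> Complex x y"
  shows "pentagon_cond E (cnj E) (of_real (2 * x + 2 * p)) \<longleftrightarrow> Q52 x y p = 0"
proof -
  define F where "F = cnj E"
  have xE: "E + F = 2 * of_real x" unfolding E_def F_def by (simp add: complex_eq_iff)
  have R: "E * F = (of_real x)\<^sup>2 + (of_real y)\<^sup>2"
    unfolding E_def F_def by (simp add: complex_eq_iff power2_eq_square)
  define d :: complex where "d = of_real (2 * x + 2 * p)"
  have "(E\<^sup>2 - E * d + 1) * (F\<^sup>2 - F * d + 1) - E * F * (E * F - 1)\<^sup>2 =
      (E * F)\<^sup>2 + (E + F)\<^sup>2 - 2 * (E * F) + 1 - d * (E + F) * (E * F + 1) + d\<^sup>2 * (E * F) -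
      E * F * (E * F - 1)\<^sup>2"
    by algebra
  also have "\<dots> = of_real (Q52 x y p)"
    unfolding xE R d_def Q52_def by (simp add: algebra_simps power2_eq_square power3_eq_cube)
  finally have "(E\<^sup>2 - E * d + 1) * (F\<^sup>2 - F * d + 1) - E * F * (E * F - 1)\<^sup>2 = of_real (Q52 x y p)" .
  then show ?thesis
    unfolding pentagon_cond_def F_def[symmetric] d_def[symmetric] by (metis eq_iff_diff_eq_0 of_real_eq_0_iff)
qed

lemma poncelet_pair_5_iff:
  fixes x y p :: real
  assumes p: "p \<noteq> 0" and E: "(x, y) \<notin> Sigma5"
  shows "poncelet_pair 5 (unit_circle_at x y) (parabola p) \<longleftrightarrow> Q52 x y p = 0"
proof -
  define E where "E = Complex x y"
  define d :: complex where "d = of_real (2 * x + 2 * p)"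
  have "E \<noteq> 0" using E unfolding E_def Sigma5_def by (auto simp: complex_eq_iff)
  have "E * cnj E = of_real (x\<^sup>2 + y\<^sup>2)"
    unfolding E_def by (simp add: complex_mult_cnj)
  moreover have "x\<^sup>2 + y\<^sup>2 \<noteq> 1"
    using E by (simp add: Sigma5_def S1_def)
  ultimately have EF: "E * cnj E \<noteq> 1"
    by (metis of_real_eq_1_iff)
  have tangent: "joining_line_tangent (parabola p) (circle_point x y P) (circle_point x y Q) \<longleftrightarrow>
      edge_form E (cnj E) d P Q = 0" if "cross P Q \<noteq> 0" for P Q
    using joining_line_tangent_iff[OF p that] unfolding E_def d_def .
  have "poncelet_pair 5 (unit_circle_at x y) (parabola p) \<longleftrightarrow> pentagon_cond E (cnj E) d"
  proof
    assume "poncelet_pair 5 (unit_circle_at x y) (parabola p)"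
    then obtain V where V: "poncelet_polygon 5 (unit_circle_at x y) (parabola p) V"
      unfolding poncelet_pair_def by blast
    then have "\<exists>P. P \<noteq> (0, 0) \<and> V i = circle_point x y P" if "i < 5" for i
      using that on_conic_circle_pointE unfolding poncelet_polygon_def by metis
    then obtain P where P: "\<And>i. i < 5 \<Longrightarrow> P i \<noteq> (0, 0) \<and> V i = circle_point x y (P i)"
      by metis
    have cross: "cross (P i) (P j) \<noteq> 0" if "i < 5" "j < 5" "i \<noteq> j" for i j
      using V P that same_point_circle_point unfolding poncelet_polygon_def by metis
    have edge: "edge_form E (cnj E) d (P i) (P (Suc i mod 5)) = 0" if "i < 5" for i
    proof -
      have "Suc i mod 5 < 5" "i \<noteq> Suc i mod 5" using that by presburger+
      moreover from this have "cross (P i) (P (Suc i mod 5)) \<noteq> 0" using cross that by blast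
      ultimately show ?thesis
        using V P that tangent unfolding poncelet_polygon_def by metis
    qed
    have succ: "Suc 0 mod 5 = 1" "Suc 1 mod 5 = 2" "Suc 2 mod 5 = 3" "Suc 3 mod 5 = 4" "Suc 4 mod 5 = 0"
      by simp_all
    have "pentagon E (cnj E) d (P 0) (P 1) (P 2) (P 3) (P 4)"
      unfolding pentagon_def
      using edge[of 0] edge[of 1] edge[of 2] edge[of 3] edge[of 4] unfolding succ by (simp add: cross)
    then show "pentagon_cond E (cnj E) d" using EF by (rule pentagon_closing)
  next
    assume "pentagon_cond E (cnj E) d"
    then obtain P0 P1 P2 P3 P4 where pent: "pentagon E (cnj E) d P0 P1 P2 P3 P4"
      using pentagon_exists[OF _ _ _ EF] \<open>E \<noteq> 0\<close> complex_cnj_zero_iff by metis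
    define P where "P i = [P0, P1, P2, P3, P4] ! i" for i
    have all5: "(\<forall>i<5. R i) \<longleftrightarrow> R 0 \<and> R 1 \<and> R 2 \<and> R 3 \<and> R 4" for R :: "nat \<Rightarrow> bool"
    proof -
      have "(\<forall>i<5. R i) \<longleftrightarrow> (\<forall>i\<in>{..<5}. R i)" by auto
      then show ?thesis unfolding lessThan_5_nat by simp
    qed
    have "\<forall>i<5. \<forall>j<5. i < j \<longrightarrow> cross (P i) (P j) \<noteq> 0"
      using pent unfolding all5 pentagon_def P_def by simp
    then have cross: "\<forall>i<5. \<forall>j<5. i \<noteq> j \<longrightarrow> cross (P i) (P j) \<noteq> 0"
      using cross_eq_0_commute by (metis linorder_neqE_nat)
    have nz: "\<forall>i<5. P i \<noteq> (0, 0)"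
    proof (intro allI impI notI)
      fix i :: nat assume i: "i < 5" "P i = (0, 0)"
      then have "cross (P i) (P j) = 0" for j by (simp add: cross_def split: prod.split)
      moreover have "Suc i mod 5 < 5" "i \<noteq> Suc i mod 5" using i by presburger+
      ultimately show False using cross i by blast
    qed
    have edge: "\<forall>i<5. edge_form E (cnj E) d (P i) (P (Suc i mod 5)) = 0"
      using pent unfolding all5 pentagon_def P_def by simp
    have "poncelet_polygon 5 (unit_circle_at x y) (parabola p) (\<lambda>i. circle_point x y (P i))"
      unfolding poncelet_polygon_def
    proof (intro conjI)
      show "\<forall>i<5. on_conic (unit_circle_at x y) (circle_point x y (P i))"
        using nz on_conic_circle_point by blast
      show "\<forall>i<5. \<forall>j<5. i \<noteq> j \<longrightarrow> \<not> same_point (circle_point x y (P i)) (circle_point x y (P j))"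
        using nz cross same_point_circle_point by blast
      show "\<forall>i<5. joining_line_tangent (parabola p) (circle_point x y (P i)) (circle_point x y (P (Suc i mod 5)))"
      proof (intro allI impI)
        fix i :: nat assume i: "i < 5"
        then have "Suc i mod 5 < 5" "i \<noteq> Suc i mod 5" by presburger+
        then show "joining_line_tangent (parabola p) (circle_point x y (P i)) (circle_point x y (P (Suc i mod 5)))"
          using tangent cross edge i by blast
      qed
    qed simp
    then show "poncelet_pair 5 (unit_circle_at x y) (parabola p)"
      unfolding poncelet_pair_def
      using smooth_conic_unit_circle_at smooth_conic_parabola_iff p by blast
  qed
  then show ?thesis
    using pentagon_cond_iff_Q52[of x y p] unfolding E_def d_def by simp
qed

lemma Q52_0: "(x, y) \<notin> S1 \<Longrightarrow> Q52 x y 0 \<noteq> 0"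
  by (simp add: Q52_def S1_def)

lemma poncelet_parameters:
  assumes "(x, y) \<notin> Sigma5"
  shows "{p. p \<noteq> 0 \<and> poncelet_pair 5 (unit_circle_at x y) (parabola p)} = {p. Q52 x y p = 0}"
proof -
  have "Q52 x y 0 \<noteq> 0" using assms Q52_0 by (simp add: Sigma5_def)
  then have "p \<noteq> 0 \<and> poncelet_pair 5 (unit_circle_at x y) (parabola p) \<longleftrightarrow> Q52 x y p = 0" for p
    using poncelet_pair_5_iff[OF _ assms] by (cases "p = 0") simp_all
  then show ?thesis by simp
qed

lemma Gamma5_discriminant: "(x\<^sup>2 + y\<^sup>2 - y) * (x\<^sup>2 + y\<^sup>2 + y) = (x\<^sup>2 + y\<^sup>2)\<^sup>2 - y\<^sup>2" for x y :: real
  by algebra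

lemma Q52_complete_square:
  "4 * (x\<^sup>2 + y\<^sup>2) * Q52 x y p = (4 * (x\<^sup>2 + y\<^sup>2) * p + 2 * x * (x\<^sup>2 + y\<^sup>2 - 1))\<^sup>2 -
     (2 * (x\<^sup>2 + y\<^sup>2 - 1))\<^sup>2 * ((x\<^sup>2 + y\<^sup>2)\<^sup>2 - y\<^sup>2)"
  unfolding Q52_def by algebra

lemma Q52_zeros:
  assumes "(x, y) \<noteq> (0, 0)" "(x\<^sup>2 + y\<^sup>2)\<^sup>2 - y\<^sup>2 \<ge> 0"
  shows "{p. Q52 x y p = 0} = {p_plus x y, p_minus x y}"
proof -
  define R s where "R = x\<^sup>2 + y\<^sup>2" and "s = sqrt (R\<^sup>2 - y\<^sup>2)"
  have R: "R \<noteq> 0" using assms(1) unfolding R_def by (simp add: sum_power2_eq_zero_iff)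
  have s: "s\<^sup>2 = R\<^sup>2 - y\<^sup>2" using assms(2) unfolding s_def R_def by simp
  have "Q52 x y p = 0 \<longleftrightarrow> p = p_plus x y \<or> p = p_minus x y" for p
  proof -
    have "Q52 x y p = 0 \<longleftrightarrow> 4 * R * Q52 x y p = 0" using R by simp
    also have "\<dots> \<longleftrightarrow> (4 * R * p + 2 * x * (R - 1))\<^sup>2 = (2 * (R - 1) * s)\<^sup>2"
      using Q52_complete_square[of x y p] s unfolding R_def by (simp add: power_mult_distrib)
    also have "\<dots> \<longleftrightarrow> 4 * R * p + 2 * x * (R - 1) = 2 * (R - 1) * s \<or>
        4 * R * p + 2 * x * (R - 1) = - (2 * (R - 1) * s)"
      by (rule power2_eq_iff)
    also have "\<dots> \<longleftrightarrow> p = (- x + s) * (R - 1) / (2 * R) \<or> p = (- x - s) * (R - 1) / (2 * R)"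
      using R by (auto simp: field_simps)
    finally show ?thesis unfolding p_plus_def p_minus_def s_def R_def .
  qed
  then show ?thesis by auto
qed

lemma Q52_no_zeros:
  assumes "(x\<^sup>2 + y\<^sup>2)\<^sup>2 - y\<^sup>2 < 0" "(x, y) \<notin> S1"
  shows "Q52 x y p \<noteq> 0"
proof
  assume "Q52 x y p = 0"
  then have "(4 * (x\<^sup>2 + y\<^sup>2) * p + 2 * x * (x\<^sup>2 + y\<^sup>2 - 1))\<^sup>2 =
      (2 * (x\<^sup>2 + y\<^sup>2 - 1))\<^sup>2 * ((x\<^sup>2 + y\<^sup>2)\<^sup>2 - y\<^sup>2)"
    using Q52_complete_square[of x y p] by simp
  moreover have "(2 * (x\<^sup>2 + y\<^sup>2 - 1))\<^sup>2 * ((x\<^sup>2 + y\<^sup>2)\<^sup>2 - y\<^sup>2) < 0"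
    using assms by (intro mult_pos_neg) (auto simp: S1_def)
  ultimately show False by (metis not_less zero_le_power2)
qed

lemma Gamma5_neg_not_S1: "(x, y) \<in> Gamma5_neg \<Longrightarrow> (x, y) \<notin> S1"
proof
  assume neg: "(x, y) \<in> Gamma5_neg" and S1: "(x, y) \<in> S1"
  have "(x\<^sup>2 + y\<^sup>2)\<^sup>2 - y\<^sup>2 < 0" using neg unfolding Gamma5_neg_def Gamma5_discriminant by simp
  moreover have "x\<^sup>2 + y\<^sup>2 = 1" using S1 by (simp add: S1_def)
  ultimately show False using zero_le_power2[of x] by simp
qed

lemma Gamma5_double_zero:
  assumes "(x, y) \<in> Gamma5 - Sigma5"
  shows "0 < \<bar>y\<bar>" "\<bar>y\<bar> < 1" "p_plus x y = p_minus x y" "p_plus x y = p_double x y"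
    "x > 0 \<Longrightarrow> y > 0 \<Longrightarrow> p_plus x y = sqrt y * (1 - y) powr (3 / 2) / (2 * y)"
proof -
  define b where "b = \<bar>y\<bar>"
  have nS: "x\<^sup>2 + y\<^sup>2 \<noteq> 1" "(x, y) \<noteq> (0, 0)" using assms by (auto simp: Sigma5_def S1_def)
  have disc: "(x\<^sup>2 + y\<^sup>2)\<^sup>2 - y\<^sup>2 = 0"
    using assms unfolding Gamma5_def Gamma5_discriminant by simp
  then have "(x\<^sup>2 + y\<^sup>2)\<^sup>2 = b\<^sup>2" unfolding b_def by simp
  then have R: "x\<^sup>2 + y\<^sup>2 = b" unfolding b_def by (rule power2_eq_imp_eq) simp_all
  have "b \<noteq> 0" using R nS(2) by (metis prod.inject sum_power2_eq_zero_iff)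
  then show b0: "0 < \<bar>y\<bar>" by (simp add: b_def)
  have xb: "x\<^sup>2 = b * (1 - b)" using R unfolding b_def by (simp add: power2_eq_square algebra_simps)
  then have "b * (1 - b) \<ge> 0" by (metis zero_le_power2)
  then have "b \<le> 1" using b0 by (simp add: b_def zero_le_mult_iff)
  moreover have "b \<noteq> 1" using R nS(1) by simp
  ultimately show b1: "\<bar>y\<bar> < 1" by (simp add: b_def)
  have b: "0 < b" "b < 1" using b0 b1 by (auto simp: b_def)
  have plus: "p_plus x y = x * (1 - b) / (2 * b)"
    using disc unfolding p_plus_def R by (simp add: algebra_simps)
  show "p_plus x y = p_minus x y"
    using disc unfolding p_plus_def p_minus_def by simp
  have "\<bar>x\<bar> = sqrt (b * (1 - b))" using xb by (metis real_sqrt_abs)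
  then have "x = sgn x * (sqrt b * sqrt (1 - b))"
    by (metis mult_sgn_abs mult.commute real_sqrt_mult)
  moreover have "(1 - b) powr (3 / 2) = (1 - b) * sqrt (1 - b)"
  proof -
    have "(1 - b) powr (3 / 2) = (1 - b) powr (1 + 1 / 2)" by simp
    also have "\<dots> = (1 - b) * sqrt (1 - b)"
      using b by (subst powr_add) (simp add: powr_half_sqrt)
    finally show ?thesis .
  qed
  ultimately show double: "p_plus x y = p_double x y"
    unfolding plus p_double_def b_def[symmetric] by (metis (no_types, lifting) mult.assoc mult.commute times_divide_eq_right)
  show "p_plus x y = sqrt y * (1 - y) powr (3 / 2) / (2 * y)" if "x > 0" "y > 0"
    using double that by (simp add: p_double_def)
qed

theorem proposition4p2:
  fixes xE yE :: real
  shows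
    "((xE, yE) \<in> Gamma5_pos - S1 \<longrightarrow>
        p_plus xE yE \<noteq> p_minus xE yE \<and>
        {p. Q52 xE yE p = 0} = {p_plus xE yE, p_minus xE yE} \<and>
        {p. p \<noteq> 0 \<and> poncelet_pair 5 (unit_circle_at xE yE) (parabola p)}
          = {p_plus xE yE, p_minus xE yE})
     \<and>
     ((xE, yE) \<in> Gamma5 - Sigma5 \<longrightarrow>
        0 < \<bar>yE\<bar> \<and> \<bar>yE\<bar> < 1 \<and>
        p_plus xE yE = p_minus xE yE \<and>
        p_plus xE yE = p_double xE yE \<and>
        (xE > 0 \<and> yE > 0 \<longrightarrow>
          p_plus xE yE = sqrt yE * (1 - yE) powr (3 / 2) / (2 * yE)) \<and>
        {p. p \<noteq> 0 \<and> poncelet_pair 5 (unit_circle_at xE yE) (parabola p)}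
          = {p_plus xE yE})
     \<and>
     ((xE, yE) \<in> Gamma5_neg \<longrightarrow>
        {p. p \<noteq> 0 \<and> poncelet_pair 5 (unit_circle_at xE yE) (parabola p)} = {})"
proof (intro conjI impI)
  assume E: "(xE, yE) \<in> Gamma5_pos - S1"
  then have disc: "(xE\<^sup>2 + yE\<^sup>2)\<^sup>2 - yE\<^sup>2 > 0" unfolding Gamma5_pos_def Gamma5_discriminant by simp
  then have nz: "(xE, yE) \<noteq> (0, 0)" by auto
  then have R: "xE\<^sup>2 + yE\<^sup>2 \<noteq> 0" "xE\<^sup>2 + yE\<^sup>2 \<noteq> 1"
    using E by (auto simp: S1_def sum_power2_eq_zero_iff)
  show "p_plus xE yE \<noteq> p_minus xE yE"
  proof -
    have "(- x + s) * (R - 1) / (2 * R) - (- x - s) * (R - 1) / (2 * R) = s * (R - 1) / R"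
      if "R \<noteq> 0" for x s R :: real
      using that by (simp add: field_simps)
    then have "p_plus xE yE - p_minus xE yE =
        sqrt ((xE\<^sup>2 + yE\<^sup>2)\<^sup>2 - yE\<^sup>2) * (xE\<^sup>2 + yE\<^sup>2 - 1) / (xE\<^sup>2 + yE\<^sup>2)"
      using R(1) unfolding p_plus_def p_minus_def by blast
    also have "\<dots> \<noteq> 0" using disc R by simp
    finally show ?thesis by simp
  qed
  show zeros: "{p. Q52 xE yE p = 0} = {p_plus xE yE, p_minus xE yE}"
    using Q52_zeros nz disc by simp
  show "{p. p \<noteq> 0 \<and> poncelet_pair 5 (unit_circle_at xE yE) (parabola p)} = {p_plus xE yE, p_minus xE yE}"
    unfolding zeros[symmetric] using E nz by (intro poncelet_parameters) (auto simp: Sigma5_def)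
next
  assume E: "(xE, yE) \<in> Gamma5 - Sigma5"
  note double = Gamma5_double_zero[OF E]
  show "0 < \<bar>yE\<bar>" "\<bar>yE\<bar> < 1" "p_plus xE yE = p_minus xE yE" "p_plus xE yE = p_double xE yE"
    using double(1-4) .
  show "p_plus xE yE = sqrt yE * (1 - yE) powr (3 / 2) / (2 * yE)" if "xE > 0 \<and> yE > 0"
    using double(5) that by blast
  have "(xE\<^sup>2 + yE\<^sup>2)\<^sup>2 - yE\<^sup>2 = 0"
    using E unfolding Gamma5_def Gamma5_discriminant by simp
  then have "{p. Q52 xE yE p = 0} = {p_plus xE yE}"
    using Q52_zeros[of xE yE] E double(3) by (simp add: Sigma5_def)
  then show "{p. p \<noteq> 0 \<and> poncelet_pair 5 (unit_circle_at xE yE) (parabola p)} = {p_plus xE yE}"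
    using poncelet_parameters E by simp
next
  assume E: "(xE, yE) \<in> Gamma5_neg"
  then have disc: "(xE\<^sup>2 + yE\<^sup>2)\<^sup>2 - yE\<^sup>2 < 0" unfolding Gamma5_neg_def Gamma5_discriminant by simp
  have "(xE, yE) \<notin> S1" using Gamma5_neg_not_S1 E .
  moreover from this have "(xE, yE) \<notin> Sigma5" using disc by (auto simp: Sigma5_def)
  ultimately show "{p. p \<noteq> 0 \<and> poncelet_pair 5 (unit_circle_at xE yE) (parabola p)} = {}"
    using poncelet_parameters Q52_no_zeros[OF disc] by simp
qed

end
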